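(* Let $G$ be a graph with $G\in\mathfrak{N}$ and let $H$ be an $r$-regular graph. Then the strong tensor product $G\otimes H$ belongs to $\mathfrak{N}$. Moreover, $w(G\otimes H)\leq w(G)\cdot(r+1)$ and $W(G\otimes H)\geq W(G)\cdot(r+1)$.
   Context: All graphs are finite, undirected, without loops or multiple edges. An edge coloring of a graph $G$ with colors $1,2,\ldots,t$ is an interval $t$-coloring if every color $i\in\{1,\ldots,t\}$ is used on at least one edge, and for every vertex $v$ the colors of the edges incident to $v$ are pairwise distinct and form an interval of consecutive integers. $G$ is interval colorable if it has an interval $t$-coloring for some integer $t\geq 1$; $\mathfrak{N}$ denotes the set of interval colorable graphs. For $G\in\mathfrak{N}$, $w(G)$ and $W(G)$ denote the least and greatest $t$ for which $G$ has an interval $t$-coloring. The strong tensor (semistrong) product $G\otimes H$ has vertex set $V(G)\times V(H)$, with $(u_1,v_1)$ adjacent to $(u_2,v_2)$ iff either ($u_1u_2\in E(G)$ and $v_1v_2\in E(H)$) or ($v_1=v_2$ and $u_1u_2\in E(G)$). *)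

theory Defs
  imports "Graph_Theory.Pair_Digraph"
begin

text \<open>
  A finite simple undirected graph is represented by \<^locale>\<open>pair_graph\<close>: a finite, loop-free,
  symmetric digraph without parallel arcs. An undirected edge \<open>uv\<close> corresponds to the two arcs
  \<open>(u, v)\<close> and \<open>(v, u)\<close>. Colorings live on the undirected edges \<open>{u, v}\<close>, so that both
  arcs carry the same color.
\<close>

definition edges :: "'a pair_pre_digraph \<Rightarrow> 'a set set" where
  "edges G = {{u, v} | u v. (u, v) \<in> parcs G}"

definition incident_edges :: "'a pair_pre_digraph \<Rightarrow> 'a \<Rightarrow> 'a set set" where
  "incident_edges G v = {e \<in> edges G. v \<in> e}"

text \<open>
  The empty set of colors at an isolated vertex counts as an interval (\<open>{a..b}\<close> with \<open>b < a\<close>).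
\<close>
definition interval_coloring ::
    "'a pair_pre_digraph \<Rightarrow> nat \<Rightarrow> ('a set \<Rightarrow> nat) \<Rightarrow> bool" where
  "interval_coloring G t c \<longleftrightarrow>
     c ` edges G = {1..t} \<and>
     (\<forall>v \<in> pverts G. inj_on c (incident_edges G v) \<and>
        (\<exists>a b. c ` incident_edges G v = {a..b}))"

definition interval_spectrum :: "'a pair_pre_digraph \<Rightarrow> nat set" where
  "interval_spectrum G = {t. 1 \<le> t \<and> (\<exists>c. interval_coloring G t c)}"

definition interval_colorable_graphs :: "'a pair_pre_digraph set" (\<open>\<NN>\<close>) where
  "\<NN> = {G. pair_graph G \<and> interval_spectrum G \<noteq> {}}"

text \<open>
  Both are meaningful only for graphs in \<open>\<NN>\<close>, whose spectrum is nonempty and finite.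
\<close>
definition w_int :: "'a pair_pre_digraph \<Rightarrow> nat" where
  "w_int G = (LEAST t. t \<in> interval_spectrum G)"

definition W_int :: "'a pair_pre_digraph \<Rightarrow> nat" where
  "W_int G = (GREATEST t. t \<in> interval_spectrum G)"

text \<open>In a symmetric digraph the out-degree of a vertex is its undirected degree.\<close>
definition regular :: "nat \<Rightarrow> 'a pair_pre_digraph \<Rightarrow> bool" where
  "regular r G \<longleftrightarrow> (\<forall>v \<in> pverts G. out_degree (with_proj G) v = r)"

definition strong_tensor_product ::
    "'a pair_pre_digraph \<Rightarrow> 'b pair_pre_digraph \<Rightarrow> ('a \<times> 'b) pair_pre_digraph" where
  "strong_tensor_product G H =
     \<lparr>pverts = pverts G \<times> pverts H,
      parcs = {((u1, v1), (u2, v2)) | u1 v1 u2 v2.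
                 v1 \<in> pverts H \<and> v2 \<in> pverts H \<and>
                 ((u1, u2) \<in> parcs G \<and> (v1, v2) \<in> parcs H \<or>
                  v1 = v2 \<and> (u1, u2) \<in> parcs G)}\<rparr>"

lemma finite_interval_spectrum:
  assumes "pair_graph G"
  shows "finite (interval_spectrum G)"
proof -
  interpret pair_graph G by fact
  have "edges G = (\<lambda>(u, v). {u, v}) ` parcs G"
    by (auto simp: edges_def)
  then have fin: "finite (edges G)"
    using pair_finite_arcs by simp
  have "t \<le> card (edges G)" if t: "t \<in> interval_spectrum G" for t
  proof -
    obtain c where "c ` edges G = {1..t}"
      using t unfolding interval_spectrum_def interval_coloring_def by blast
    then show ?thesis
      using card_image_le[OF fin, of c] by simp
  qed
  then show ?thesis
    by (meson finite_nat_set_iff_bounded_le)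
qed

lemma w_int_eq_Min:
  assumes "G \<in> \<NN>"
  shows "w_int G = Min (interval_spectrum G)"
  using assms finite_interval_spectrum[of G]
  by (simp add: w_int_def Least_Min interval_colorable_graphs_def ex_in_conv)

lemma W_int_eq_Max:
  assumes "G \<in> \<NN>"
  shows "W_int G = Max (interval_spectrum G)"
  unfolding W_int_def using assms finite_interval_spectrum[of G]
  by (intro Greatest_equality) (auto simp: interval_colorable_graphs_def)

lemma pair_graph_strong_tensor_product:
  assumes "pair_graph G" "pair_graph H"
  shows "pair_graph (strong_tensor_product G H)"
proof -
  interpret G: pair_graph G by fact
  interpret H: pair_graph H by fact
  have sub: "parcs (strong_tensor_product G H)
      \<subseteq> (pverts G \<times> pverts H) \<times> (pverts G \<times> pverts H)"
    by (auto simp: strong_tensor_product_def dest: G.wellformed' H.wellformed')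
  show ?thesis
  proof
    show "finite (parcs (strong_tensor_product G H))"
      using sub by (rule finite_subset) (simp add: G.pair_finite_verts H.pair_finite_verts)
    show "symmetric (with_proj (strong_tensor_product G H))"
      unfolding symmetric_def with_proj_simps
      by (rule symI)
        (unfold strong_tensor_product_def, use G.arcs_symmetric H.arcs_symmetric in fastforce)
  qed (use sub in \<open>auto simp: strong_tensor_product_def G.pair_finite_verts H.pair_finite_verts
         dest: G.no_loops' G.wellformed'\<close>)
qed

end

theory Submission
  imports Defs
begin

text \<open>
  Put a loop at every vertex of \<open>H\<close>: over each edge \<open>uw\<close> of \<open>G\<close> the product is then an
  \<open>(r + 1)\<close>-regular bipartite graph between the fibres of \<open>u\<close> and \<open>w\<close>, so by Koenig's theorem
  (iterated Hall) it splits into \<open>r + 1\<close> perfect matchings. Colouring them with the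
  \<open>k\<close>-th block of \<open>r + 1\<close> consecutive colours, where \<open>k\<close> is the colour of \<open>uw\<close>, every
  vertex sees exactly the full blocks of the colours seen by its projection to \<open>G\<close>. Hence an
  interval \<open>t\<close>-colouring of \<open>G\<close> yields an interval \<open>t (r + 1)\<close>-colouring of the product.
\<close>

section \<open>Hall's theorem and regular bipartite relations\<close>

text \<open>Induction on the size of \<open>I\<close>, after Halmos and Vaughan. If some nonempty
  proper \<open>J\<close> is tight, match \<open>J\<close> inside its own neighbourhood and the rest
  outside it. Otherwise every nonempty proper subset has a spare value, so one index may take any
  value it likes.\<close>

theorem Hall_marriage:
  fixes A :: "'i \<Rightarrow> 'a set"
  assumes "finite I" and "\<And>i. i \<in> I \<Longrightarrow> finite (A i)"
    and "\<And>J. J \<subseteq> I \<Longrightarrow> card J \<le> card (\<Union>(A ` J))"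
  shows "\<exists>f. inj_on f I \<and> (\<forall>i\<in>I. f i \<in> A i)"
  using assms
proof (induction I arbitrary: A rule: finite_psubset_induct)
  case (psubset I)
  note fin = psubset.prems(1) and hall = psubset.prems(2)
  have finU: "finite (\<Union>(A ` J))" if "J \<subseteq> I" for J
    using that fin psubset.hyps by (auto intro: finite_subset)
  consider "I = {}"
    | J where "J \<noteq> {}" "J \<subset> I" "card (\<Union>(A ` J)) = card J"
    | "I \<noteq> {}" "\<And>J. J \<noteq> {} \<Longrightarrow> J \<subset> I \<Longrightarrow> card J < card (\<Union>(A ` J))"
    using hall by (metis le_neq_implies_less psubset_imp_subset)
  then show ?case
  proof cases
    case 1
    then show ?thesis by simp
  next
    case (2 J)
    define U where "U = \<Union>(A ` J)"
    have finJ: "finite J" using 2(2) psubset.hyps by (auto intro: finite_subset)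
    have "\<exists>f. inj_on f J \<and> (\<forall>i\<in>J. f i \<in> A i)"
      by (rule psubset.IH[OF 2(2)]) (use 2(2) fin hall in auto)
    then obtain f where f: "inj_on f J" "\<And>i. i \<in> J \<Longrightarrow> f i \<in> A i" by blast
    have "\<exists>g. inj_on g (I - J) \<and> (\<forall>i\<in>I - J. g i \<in> A i - U)"
    proof (rule psubset.IH)
      show "I - J \<subset> I" using 2 by blast
      show "finite (A i - U)" if "i \<in> I - J" for i using that fin by blast
      show "card K \<le> card (\<Union>i\<in>K. A i - U)" if K: "K \<subseteq> I - J" for K
      proof -
        have fK: "finite K" using K psubset.hyps by (auto intro: finite_subset)
        \<comment> \<open>Hall's condition for \<open>J \<union> K\<close>, minus the tight equation
          \<open>card U = card J\<close>, is Hall's condition for \<open>K\<close> once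
          \<open>U\<close> is removed.\<close>
        have "card J + card K = card (J \<union> K)"
          using K fK finJ by (subst card_Un_disjoint) auto
        also have "\<dots> \<le> card (\<Union>(A ` (J \<union> K)))"
          using K 2(2) by (intro hall) auto
        also have "\<Union>(A ` (J \<union> K)) = U \<union> (\<Union>i\<in>K. A i - U)"
          unfolding U_def by auto
        also have "card \<dots> \<le> card U + card (\<Union>i\<in>K. A i - U)"
          by (rule card_Un_le)
        finally show ?thesis using 2(3) by (simp add: U_def)
      qed
    qed
    then obtain g where g: "inj_on g (I - J)" "\<And>i. i \<in> I - J \<Longrightarrow> g i \<in> A i - U" by blast
    have "inj_on (\<lambda>i. if i \<in> J then f i else g i) I"
    proof (rule inj_onI)
      fix x y
      assume xy: "x \<in> I" "y \<in> I" "(if x \<in> J then f x else g x) = (if y \<in> J then f y else g y)"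
      have fU: "f i \<in> U" if "i \<in> J" for i using f(2)[OF that] that by (auto simp: U_def)
      show "x = y"
        using xy fU[of x] fU[of y] g(2)[of x] g(2)[of y] inj_onD[OF f(1)] inj_onD[OF g(1)]
        by (auto split: if_splits)
    qed
    then show ?thesis
      using f(2) g(2) by (intro exI[of _ "\<lambda>i. if i \<in> J then f i else g i"]) auto
  next
    case 3
    then obtain i where i: "i \<in> I" by blast
    have "card {i} \<le> card (A i)" using hall[of "{i}"] i by simp
    then obtain x where x: "x \<in> A i" by fastforce
    have "\<exists>g. inj_on g (I - {i}) \<and> (\<forall>j\<in>I - {i}. g j \<in> A j - {x})"
    proof (rule psubset.IH)
      show "I - {i} \<subset> I" using i by blast
      show "finite (A j - {x})" if "j \<in> I - {i}" for j using that fin by blast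
      show "card K \<le> card (\<Union>j\<in>K. A j - {x})" if K: "K \<subseteq> I - {i}" for K
      proof (cases "K = {}")
        case False
        \<comment> \<open>The strict surplus pays for the possible loss of \<open>x\<close>.\<close>
        then have "card K < card (\<Union>(A ` K))" using K i by (intro 3(2)) auto
        moreover have "(\<Union>j\<in>K. A j - {x}) = \<Union>(A ` K) - {x}" by auto
        ultimately show ?thesis
          by (simp only: card_Diff_singleton_if split: if_split) linarith
      qed simp
    qed
    then obtain g where g: "inj_on g (I - {i})" "\<And>j. j \<in> I - {i} \<Longrightarrow> g j \<in> A j - {x}" by blast
    have "inj_on (g(i := x)) I"
      using g by (simp add: inj_on_def) metis
    moreover have "\<forall>j\<in>I. (g(i := x)) j \<in> A j"
      using g(2) x by auto
    ultimately show ?thesis by blast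
  qed
qed

section \<open>Koenig's edge colouring theorem for regular bipartite graphs\<close>

text \<open>A \<open>k\<close>-regular bipartite graph whose two sides are copies of the same set
  \<open>V\<close>, as two fibres of the product are. Rows and columns of \<open>R\<close> are the
  two kinds of neighbourhoods.\<close>

definition biregular_on :: "'a set \<Rightarrow> nat \<Rightarrow> 'a rel \<Rightarrow> bool" where
  "biregular_on V k R \<longleftrightarrow> R \<subseteq> V \<times> V \<and> (\<forall>x\<in>V. card (R `` {x}) = k \<and> card (R\<inverse> `` {x}) = k)"

text \<open>Hall's condition by double counting: the \<open>card J * k\<close> edges leaving
  \<open>J\<close> all end in its neighbourhood \<open>N\<close>, which receives only
  \<open>card N * k\<close>. An injection of a finite set into itself is onto.\<close>

lemma biregular_on_perfect_matching:
  assumes "finite V" and R: "biregular_on V k R" and "k > 0"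
  shows "\<exists>p. bij_betw p V V \<and> (\<forall>x\<in>V. (x, p x) \<in> R)"
proof -
  have RV: "R \<subseteq> V \<times> V" using R by (simp add: biregular_on_def)
  have finR: "finite R" using RV assms(1) by (auto intro: finite_subset)
  have "\<exists>p. inj_on p V \<and> (\<forall>x\<in>V. p x \<in> R `` {x})"
  proof (rule Hall_marriage[OF assms(1)])
    show "finite (R `` {x})" for x using finR by (rule finite_Image)
    fix J assume J: "J \<subseteq> V"
    define N where "N = (\<Union>x\<in>J. R `` {x})"
    have NV: "N \<subseteq> V" using RV by (auto simp: N_def)
    have fins: "finite J" "finite N" using J NV assms(1) by (auto intro: finite_subset)
    have "card J * k = card (SIGMA x:J. R `` {x})"
      using R J fins finR by (subst card_SigmaI) (auto simp: biregular_on_def subset_iff intro: finite_Image)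
    also have "\<dots> \<le> card (prod.swap ` (SIGMA y:N. R\<inverse> `` {y}))"
      using fins finR
      by (intro card_mono finite_imageI finite_SigmaI finite_Image)
        (force simp: N_def image_iff)+
    also have "\<dots> = card (SIGMA y:N. R\<inverse> `` {y})"
      by (intro card_image) simp
    also have "\<dots> = card N * k"
      using R NV fins finR
      by (subst card_SigmaI) (auto simp: biregular_on_def subset_iff intro: finite_Image)
    finally show "card J \<le> card (\<Union>x\<in>J. R `` {x})"
      using \<open>k > 0\<close> by (simp add: N_def)
  qed
  then obtain p where p: "inj_on p V" "\<And>x. x \<in> V \<Longrightarrow> (x, p x) \<in> R" by blast
  then have "p ` V = V"
    using RV assms(1) by (intro endo_inj_surj) auto
  with p show ?thesis by (auto simp: bij_betw_def)
qed

lemma bij_betw_insert_last: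
  assumes "bij_betw f (S - {y}) {..<k}" and "y \<in> S"
  shows "bij_betw (f(y := k)) S {..<Suc k}"
proof -
  have "bij_betw (f(y := k)) (S - {y}) {..<k}"
    using assms(1) by (subst bij_betw_cong[where g = f]) auto
  then have "bij_betw (f(y := k)) ((S - {y}) \<union> {y}) ({..<k} \<union> {k})"
    by (rule bij_betw_combine) (simp_all add: bij_betw_def)
  with assms(2) show ?thesis by (simp add: insert_absorb lessThan_Suc)
qed

text \<open>Peel off a perfect matching, give it the last colour, and recurse. Here \<open>x\<close>
  is a left and \<open>y\<close> a right vertex, so \<open>f x y\<close> and \<open>f y x\<close>
  may differ even when \<open>R\<close> is symmetric.\<close>

theorem Koenig_edge_coloring:
  assumes "finite V" and "biregular_on V k R"
  shows "\<exists>f. (\<forall>x\<in>V. bij_betw (\<lambda>y. f x y) (R `` {x}) {..<k}) \<and>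
             (\<forall>y\<in>V. bij_betw (\<lambda>x. f x y) (R\<inverse> `` {y}) {..<k})"
  using assms(2)
proof (induction k arbitrary: R)
  case 0
  \<comment> \<open>Finiteness is what lets cardinality 0 mean empty.\<close>
  have "finite (R `` {x})" "finite (R\<inverse> `` {x})" for x
    using 0 assms(1) by (auto simp: biregular_on_def intro!: finite_Image intro: finite_subset)
  with 0 show ?case
    by (auto simp: biregular_on_def bij_betw_def)
next
  case (Suc k)
  obtain p where p: "bij_betw p V V" "\<And>x. x \<in> V \<Longrightarrow> (x, p x) \<in> R"
    using biregular_on_perfect_matching[OF assms(1) Suc.prems] by blast
  define q where "q = inv_into V p"
  have q: "q y \<in> V" "p (q y) = y" if "y \<in> V" for y
    using that p(1) by (auto simp: q_def bij_betw_def inv_into_into f_inv_into_f)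
  have qp: "q (p x) = x" "p x \<in> V" if "x \<in> V" for x
    using that p(1) by (auto simp: q_def bij_betw_def)
  define R' where "R' = R - {(x, p x) | x. x \<in> V}"
  have row: "R' `` {x} = R `` {x} - {p x}" if "x \<in> V" for x
    using that by (auto simp: R'_def)
  have col: "R'\<inverse> `` {y} = R\<inverse> `` {y} - {q y}" if "y \<in> V" for y
    using that q[OF that] qp by (auto simp: R'_def)
  have pR: "p x \<in> R `` {x}" "q x \<in> R\<inverse> `` {x}" if "x \<in> V" for x
    using that p(2)[of x] p(2)[of "q x"] q[of x] by auto
  have "biregular_on V k R'"
    using Suc.prems row col pR by (auto simp: biregular_on_def R'_def)
  from Suc.IH[OF this] obtain f where
    f: "\<And>x. x \<in> V \<Longrightarrow> bij_betw (\<lambda>y. f x y) (R' `` {x}) {..<k}"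
       "\<And>y. y \<in> V \<Longrightarrow> bij_betw (\<lambda>x. f x y) (R'\<inverse> `` {y}) {..<k}" by blast
  define g where "g x y = (if y = p x then k else f x y)" for x y
  have "bij_betw (\<lambda>y. g x y) (R `` {x}) {..<Suc k}" if x: "x \<in> V" for x
  proof -
    have "(\<lambda>y. g x y) = (\<lambda>y. f x y)(p x := k)" by (auto simp: g_def)
    moreover have "bij_betw ((\<lambda>y. f x y)(p x := k)) (R `` {x}) {..<Suc k}"
      using f(1)[OF x] pR(1)[OF x] unfolding row[OF x] by (rule bij_betw_insert_last)
    ultimately show ?thesis by (simp only:)
  qed
  moreover have "bij_betw (\<lambda>x. g x y) (R\<inverse> `` {y}) {..<Suc k}" if y: "y \<in> V" for y
  proof -
    have "bij_betw ((\<lambda>x. f x y)(q y := k)) (R\<inverse> `` {y}) {..<Suc k}"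
      using f(2)[OF y] pR(2)[OF y] unfolding col[OF y] by (rule bij_betw_insert_last)
    \<comment> \<open>For \<open>x\<close> in \<open>V\<close>, the test \<open>y = p x\<close> in
      \<open>g\<close> amounts to \<open>x = q y\<close>: column \<open>y\<close> loses just its
      matching partner.\<close>
    moreover have "g x y = ((\<lambda>x. f x y)(q y := k)) x" if "x \<in> R\<inverse> `` {y}" for x
    proof -
      have "x \<in> V" using that Suc.prems by (auto simp: biregular_on_def)
      then show ?thesis using q[OF y] qp by (auto simp: g_def)
    qed
    ultimately show ?thesis by (subst bij_betw_cong) auto
  qed
  ultimately show ?case by blast
qed

section \<open>Interval colorings of the product\<close>

lemma incident_edges_eq_image:
  assumes "pair_graph G"
  shows "incident_edges G v = (\<lambda>w. {v, w}) ` (parcs G `` {v})"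
proof -
  interpret pair_graph G by fact
  show ?thesis
    by (auto simp: incident_edges_def edges_def insert_commute dest: arcs_symmetric)
qed

lemma edges_eq_UN_incident_edges:
  assumes "pair_graph G"
  shows "edges G = (\<Union>v\<in>pverts G. incident_edges G v)"
proof -
  interpret pair_graph G by fact
  show ?thesis
    by (auto simp: incident_edges_def edges_def dest: wellformed')
qed

text \<open>Colours are computed on arcs but must live on unordered edges. Any chosen ordering of
  the two ends will do, by symmetry of \<open>g\<close> on \<open>A\<close>.\<close>

lemma edge_function_of_symmetric:
  fixes g :: "'a \<Rightarrow> 'a \<Rightarrow> 'b"
  assumes "\<And>x y. (x, y) \<in> A \<Longrightarrow> g x y = g y x"
  obtains c where "\<And>x y. (x, y) \<in> A \<Longrightarrow> c {x, y} = g x y"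
proof -
  define P where "P E = (SOME p. E = {fst p, snd p})" for E :: "'a set"
  have "g (fst (P {x, y})) (snd (P {x, y})) = g x y" if "(x, y) \<in> A" for x y
  proof -
    have "{x, y} = {fst (P {x, y}), snd (P {x, y})}"
      unfolding P_def by (rule someI[of _ "(x, y)"]) simp
    then show ?thesis using assms[OF that] by (auto simp: doubleton_eq_iff)
  qed
  then show ?thesis
    by (rule that[of "\<lambda>E. g (fst (P E)) (snd (P E))"])
qed

section \<open>Blocks of consecutive colours\<close>

text \<open>For positive \<open>m\<close>, each positive colour \<open>k\<close> in \<open>C\<close>
  is blown up to the \<open>m\<close> colours from \<open>(k - 1) * m + 1\<close> to
  \<open>k * m\<close>. The shifts by 1 are there because colours start at 1.\<close>

definition blocks :: "nat \<Rightarrow> nat set \<Rightarrow> nat set" where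
  "blocks m C = {n. 1 \<le> n \<and> (n - 1) div m + 1 \<in> C}"

lemma blocks_UN: "blocks m (\<Union>i\<in>I. C i) = (\<Union>i\<in>I. blocks m (C i))"
  by (auto simp: blocks_def)

lemma blocks_atLeastAtMost:
  assumes "m > 0" and "1 \<le> a"
  shows "blocks m {a..b} = {(a - 1) * m + 1..b * m}"
proof -
  have "a \<le> (n - 1) div m + 1 \<longleftrightarrow> (a - 1) * m + 1 \<le> n" if "1 \<le> n" for n
    using less_eq_div_iff_mult_less_eq[OF assms(1), of "a - 1" "n - 1"] that assms(2) by linarith
  moreover have "(n - 1) div m + 1 \<le> b \<longleftrightarrow> n \<le> b * m" if "1 \<le> n" for n
    using div_less_iff_less_mult[OF assms(1), of "n - 1" b] that by linarith
  ultimately show ?thesis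
    by (auto simp: blocks_def)
qed

lemma blocks_interval:
  assumes "m > 0" and "C = {a..b}" and "0 \<notin> C"
  shows "\<exists>a b. blocks m C = {a..b}"
proof (cases "1 \<le> a")
  case True
  with assms show ?thesis by (auto simp: blocks_atLeastAtMost)
next
  case False
  \<comment> \<open>Now \<open>a = 0\<close>, and \<open>{0..b}\<close> contains 0, so the
    assumptions are contradictory.\<close>
  with assms have "C = {}" by (auto simp: not_le)
  then show ?thesis by (intro exI[of _ 1] exI[of _ 0]) (auto simp: blocks_def)
qed

text \<open>Division with remainder: for a colour \<open>n\<close>, the quotient of
  \<open>n - 1\<close> by \<open>m\<close> determines \<open>d w\<close> and hence \<open>w\<close>,
  and the remainder is \<open>F w x\<close>, which determines \<open>x\<close>. As
  \<open>0 \<notin> C\<close>, the subtraction \<open>d w - 1\<close> never truncates.\<close>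

lemma bij_betw_blocks:
  fixes F :: "'a \<Rightarrow> 'b \<Rightarrow> nat"
  assumes "m > 0" and d: "bij_betw d N C" "0 \<notin> C"
    and F: "\<And>w. w \<in> N \<Longrightarrow> bij_betw (F w) S {..<m}"
  shows "bij_betw (\<lambda>(w, x). m * (d w - 1) + F w x + 1) (N \<times> S) (blocks m C)"
proof -
  have pos: "d w > 0" if "w \<in> N" for w
    using that d by (metis bij_betwE gr0I)
  have less: "F w x < m" if "w \<in> N" "x \<in> S" for w x
    using bij_betwE[OF F[OF that(1)]] that(2) by auto
  show ?thesis
    unfolding bij_betw_def
  proof
    show "inj_on (\<lambda>(w, x). m * (d w - 1) + F w x + 1) (N \<times> S)"
    proof (rule inj_onI, clarify)
      fix w x w' x'
      assume in_N: "w \<in> N" "w' \<in> N" and in_S: "x \<in> S" "x' \<in> S"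
        and eq: "m * (d w - 1) + F w x + 1 = m * (d w' - 1) + F w' x' + 1"
      have "(m * (d w - 1) + F w x) div m = (m * (d w' - 1) + F w' x') div m"
        using eq by simp
      then have "d w = d w'"
        using less[of w x] less[of w' x'] pos[of w] pos[of w'] in_N in_S \<open>m > 0\<close> by simp
      then have ww: "w = w'"
        using d(1) in_N by (auto simp: bij_betw_def dest: inj_onD)
      then have "F w x = F w x'" using eq by simp
      then show "w = w' \<and> x = x'"
        using ww F[OF in_N(1)] in_S by (auto simp: bij_betw_def dest: inj_onD)
    qed
    show "(\<lambda>(w, x). m * (d w - 1) + F w x + 1) ` (N \<times> S) = blocks m C"
    proof (intro equalityI subsetI)
      fix n assume "n \<in> (\<lambda>(w, x). m * (d w - 1) + F w x + 1) ` (N \<times> S)"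
      then obtain w x where wx: "w \<in> N" "x \<in> S" and n: "n = m * (d w - 1) + F w x + 1" by auto
      have "(n - 1) div m = d w - 1"
        unfolding n using less[OF wx] by simp
      then have "(n - 1) div m + 1 = d w"
        using pos[OF wx(1)] by linarith
      then show "n \<in> blocks m C"
        using bspec[OF bij_betwE[OF d(1)] wx(1)] n unfolding blocks_def by fastforce
    next
      fix n assume n: "n \<in> blocks m C"
      then have "(n - 1) div m + 1 \<in> d ` N"
        using d(1) by (simp add: blocks_def bij_betw_def)
      then obtain w where w: "w \<in> N" "(n - 1) div m + 1 = d w" ..
      have "(n - 1) mod m \<in> F w ` S"
        using F[OF w(1)] \<open>m > 0\<close> by (simp add: bij_betw_def)
      then obtain x where x: "x \<in> S" "(n - 1) mod m = F w x" by blast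
      have "n = m * ((n - 1) div m) + (n - 1) mod m + 1"
        using n by (simp add: blocks_def)
      also have "\<dots> = m * (d w - 1) + F w x + 1"
        unfolding x(2) w(2)[symmetric] by simp
      finally show "n \<in> (\<lambda>(w, x). m * (d w - 1) + F w x + 1) ` (N \<times> S)"
        using w(1) x(1) by (intro image_eqI[of _ _ "(w, x)"]) simp_all
    qed
  qed
qed

section \<open>Colouring the product\<close>

lemma interval_coloring_strong_tensor_product:
  fixes G :: "'a pair_pre_digraph" and H :: "'b pair_pre_digraph"
  assumes "pair_graph G" "pair_graph H" "pverts H \<noteq> {}" "regular r H"
    and c: "interval_coloring G t c"
  shows "\<exists>c'. interval_coloring (strong_tensor_product G H) (t * (r + 1)) c'"
proof -
  interpret G: pair_graph G by fact
  interpret H: pair_graph H by fact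
  let ?P = "strong_tensor_product G H"
  have P: "pair_graph ?P" by (rule pair_graph_strong_tensor_product) fact+
  define m where "m = r + 1"
  have "m > 0" by (simp add: m_def)
  define R where "R = parcs H \<union> Id_on (pverts H)"
  have Rconv: "R\<inverse> = R" by (auto simp: R_def intro: H.arcs_symmetric)
  have "card (R `` {v}) = m" if v: "v \<in> pverts H" for v
  proof -
    have "card (parcs H `` {v}) = card ((\<lambda>w. (v, w)) ` (parcs H `` {v}))"
      by (intro card_image[symmetric] inj_onI) simp
    also have "(\<lambda>w. (v, w)) ` (parcs H `` {v}) = out_arcs (with_proj H) v"
      by (auto simp: out_arcs_def)
    also have "card \<dots> = r"
      using assms(4) v by (simp add: regular_def out_degree_def)
    finally have "card (parcs H `` {v}) = r" .
    moreover have "R `` {v} = insert v (parcs H `` {v})" using v by (auto simp: R_def)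
    moreover have "v \<notin> parcs H `` {v}" using H.no_loops' by auto
    ultimately show ?thesis
      using H.pair_finite_arcs by (simp add: m_def finite_Image)
  qed
  then have "biregular_on (pverts H) m R"
    unfolding biregular_on_def Rconv by (auto simp: R_def dest: H.wellformed')
  from Koenig_edge_coloring[OF H.pair_finite_verts this] obtain f where
    f: "\<And>v. v \<in> pverts H \<Longrightarrow> bij_betw (\<lambda>v'. f v v') (R `` {v}) {..<m}"
       "\<And>v. v \<in> pverts H \<Longrightarrow> bij_betw (\<lambda>v'. f v' v) (R `` {v}) {..<m}"
    unfolding Rconv by blast
  have arcsP: "((u, v), (w, v')) \<in> parcs ?P \<longleftrightarrow> (u, w) \<in> parcs G \<and> (v, v') \<in> R" for u v w v'
    by (auto simp: strong_tensor_product_def R_def dest: H.wellformed')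
  \<comment> \<open>Since \<open>f\<close> tells left from right, each edge of \<open>G\<close> must
    be oriented. Choosing \<open>tail\<close> from the unordered edge makes both ends agree on which
    fibre is the left one.\<close>
  define tail :: "'a set \<Rightarrow> 'a" where "tail e = (SOME u. u \<in> e)" for e
  have tail: "tail {u, w} = u \<or> tail {u, w} = w" for u w
    using someI[of "\<lambda>x. x \<in> {u, w}" u] by (auto simp: tail_def)
  define F where "F u w v v' = (if tail {u, w} = u then f v v' else f v' v)" for u w v v'
  \<comment> \<open>The fibre of \<open>u\<close> sees a row or a column of \<open>f\<close>; both
    are indexed by the same set because \<open>R\<close> is symmetric.\<close>
  have F: "bij_betw (F u w v) (R `` {v}) {..<m}" if "v \<in> pverts H" for u w v
    using f[OF that] by (cases "tail {u, w} = u") (simp_all add: F_def[abs_def])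
  define g where
    "g x y = m * (c {fst x, fst y} - 1) + F (fst x) (fst y) (snd x) (snd y) + 1" for x y
  have g_sym: "g x y = g y x" if "(x, y) \<in> parcs ?P" for x y
  proof -
    have "(fst x, fst y) \<in> parcs G" using that arcsP[of "fst x" "snd x" "fst y" "snd y"] by simp
    \<comment> \<open>Exactly one of two distinct ends is the tail, so swapping \<open>x\<close> and
      \<open>y\<close> changes the branch of \<open>F\<close> as well as its arguments, and the two
      swaps cancel.\<close>
    then have "fst x \<noteq> fst y" using G.no_loops' by metis
    then show ?thesis
      using tail[of "fst x" "fst y"] by (auto simp: g_def F_def insert_commute)
  qed
  obtain c' where c': "\<And>x y. (x, y) \<in> parcs ?P \<Longrightarrow> c' {x, y} = g x y"
    using edge_function_of_symmetric[of "parcs ?P" g] g_sym by blast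
  have bij: "bij_betw c' (incident_edges ?P (u, v)) (blocks m (c ` incident_edges G u))"
    if u: "u \<in> pverts G" and v: "v \<in> pverts H" for u v
  proof -
    \<comment> \<open>The neighbourhood in the product is a rectangle, the shape
      \<open>bij_betw_blocks\<close> needs: the factor in \<open>G\<close> selects the block, the
      factor in \<open>H\<close> the place in it.\<close>
    have star: "parcs ?P `` {(u, v)} = parcs G `` {u} \<times> R `` {v}"
      by (auto simp: arcsP)
    have "bij_betw c (incident_edges G u) (c ` incident_edges G u)"
      using c u by (auto simp: interval_coloring_def bij_betw_def)
    moreover have "bij_betw (\<lambda>w. {u, w}) (parcs G `` {u}) (incident_edges G u)"
      unfolding incident_edges_eq_image[OF assms(1)]
      by (intro bij_betw_imageI inj_onI) (auto simp: doubleton_eq_iff)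
    ultimately have d: "bij_betw (\<lambda>w. c {u, w}) (parcs G `` {u}) (c ` incident_edges G u)"
      using bij_betw_trans[of "\<lambda>w. {u, w}" _ _ c] by (simp add: comp_def)
    have "c ` incident_edges G u \<subseteq> {1..t}"
      using c by (auto simp: interval_coloring_def incident_edges_def)
    then have "0 \<notin> c ` incident_edges G u" by auto
    from bij_betw_blocks[OF \<open>m > 0\<close> d this F[OF v]]
    have "bij_betw (g (u, v)) (parcs ?P `` {(u, v)}) (blocks m (c ` incident_edges G u))"
      unfolding star by (rule bij_betw_cong[THEN iffD1, rotated]) (auto simp: g_def)
    then have g_bij: "bij_betw (\<lambda>y. c' {(u, v), y}) (parcs ?P `` {(u, v)})
        (blocks m (c ` incident_edges G u))"
      by (rule bij_betw_cong[THEN iffD1, rotated]) (simp add: c')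
    show ?thesis
      unfolding incident_edges_eq_image[OF P]
      using g_bij by (auto simp: bij_betw_def image_image intro!: inj_on_imageI simp: comp_def)
  qed
  have "c' ` edges ?P = (\<Union>x\<in>pverts ?P. c' ` incident_edges ?P x)"
    by (simp add: edges_eq_UN_incident_edges[OF P] image_UN)
  also have "\<dots> = (\<Union>u\<in>pverts G. \<Union>v\<in>pverts H. c' ` incident_edges ?P (u, v))"
    by (auto simp: strong_tensor_product_def)
  \<comment> \<open>The colours at \<open>(u, v)\<close> do not depend on \<open>v\<close>, and a
    nonempty \<open>H\<close> supplies at least one \<open>v\<close> for each
    \<open>u\<close>.\<close>
  also have "\<dots> = (\<Union>u\<in>pverts G. blocks m (c ` incident_edges G u))"
    using bij assms(3) by (auto simp: bij_betw_def)
  also have "\<dots> = blocks m (c ` edges G)"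
    by (simp add: edges_eq_UN_incident_edges[OF assms(1)] image_UN blocks_UN)
  also have "\<dots> = {1..t * m}"
    using c \<open>m > 0\<close> by (simp add: interval_coloring_def blocks_atLeastAtMost)
  finally have "c' ` edges ?P = {1..t * m}" .
  moreover have "inj_on c' (incident_edges ?P x) \<and> (\<exists>a b. c' ` incident_edges ?P x = {a..b})"
    if x: "x \<in> pverts ?P" for x
  proof -
    obtain u v where uv: "x = (u, v)" "u \<in> pverts G" "v \<in> pverts H"
      using x by (auto simp: strong_tensor_product_def)
    have "c ` incident_edges G u \<subseteq> {1..t}"
      using c by (auto simp: interval_coloring_def incident_edges_def)
    then have "0 \<notin> c ` incident_edges G u" by auto
    moreover obtain a b where "c ` incident_edges G u = {a..b}"
      using c uv(2) unfolding interval_coloring_def by blast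
    ultimately have "\<exists>a b. blocks m (c ` incident_edges G u) = {a..b}"
      using blocks_interval[OF \<open>m > 0\<close>] by blast
    with bij[OF uv(2,3)] show ?thesis by (simp add: bij_betw_def uv(1))
  qed
  ultimately have "interval_coloring ?P (t * m) c'"
    by (simp add: interval_coloring_def)
  then show ?thesis by (auto simp: m_def)
qed

theorem theorem13:
  fixes G :: "'a pair_pre_digraph" and H :: "'b pair_pre_digraph" and r :: nat
  assumes "G \<in> \<NN>"
    and "pair_graph H" and "pverts H \<noteq> {}" and "regular r H"
  shows "strong_tensor_product G H \<in> \<NN> \<and>
    w_int (strong_tensor_product G H) \<le> w_int G * (r + 1) \<and>
    W_int (strong_tensor_product G H) \<ge> W_int G * (r + 1)"
proof -
  let ?P = "strong_tensor_product G H"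
  have G: "pair_graph G" "interval_spectrum G \<noteq> {}" and fin: "finite (interval_spectrum G)"
    using assms(1) finite_interval_spectrum by (auto simp: interval_colorable_graphs_def)
  have P: "pair_graph ?P" by (rule pair_graph_strong_tensor_product) fact+
  note finP = finite_interval_spectrum[OF P]
  \<comment> \<open>Applied to the least and the greatest \<open>t\<close>, this gives the bounds on
    \<open>w_int\<close> and \<open>W_int\<close> respectively.\<close>
  have spec: "t * (r + 1) \<in> interval_spectrum ?P" if "t \<in> interval_spectrum G" for t
    using that interval_coloring_strong_tensor_product[OF G(1) assms(2-4)]
    by (auto simp: interval_spectrum_def)
  then have PN: "?P \<in> \<NN>"
    using G P by (auto simp: interval_colorable_graphs_def)
  then show ?thesis
    unfolding w_int_eq_Min[OF PN] W_int_eq_Max[OF PN]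
      w_int_eq_Min[OF assms(1)] W_int_eq_Max[OF assms(1)]
    using spec[OF Min_in[OF fin G(2)]] spec[OF Max_in[OF fin G(2)]] finP
    by (auto intro: Min_le Max_ge)
qed

end
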